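(* For every integer $n\geq 3$ and every $\varepsilon>0$, there exists a compact set $A\subseteq\mathbb{T}$ such that, for the covering homomorphism $\pi_n:\mathbb{T}\to\mathbb{T}$, $\pi_n(x)=nx$, one has $0<\mu_{\mathbb{T}}(\pi_n(A))<\varepsilon$ and $2<\mu_{\mathbb{T}}(A+A)/\mu_{\mathbb{T}}(A)<3$, but \[ \mu_{\mathbb{T}}(\pi_n(A)+\pi_n(A))>2\bigl(\mu_{\mathbb{T}}(A+A)-\mu_{\mathbb{T}}(A)\bigr). \]
   Context: $\mathbb{T}=\mathbb{R}/\mathbb{Z}$ with normalized Lebesgue (Haar) measure $\mu_{\mathbb{T}}$. $X+Y=\{x+y:x\in X,\,y\in Y\}$. *)

theory Defs
  imports "HOL-Analysis.Analysis" "HOL-Library.Set_Algebras"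
begin

text \<open>The circle group \<open>\<real>/\<int>\<close>.\<close>

quotient_type circle = real / "\<lambda>x y :: real. x - y \<in> \<int>"
  morphisms rep_circle to_circle
proof (rule equivpI)
  show "reflp (\<lambda>x y :: real. x - y \<in> \<int>)"
    by (auto intro: reflpI)
  show "symp (\<lambda>x y :: real. x - y \<in> \<int>)"
    by (rule sympI) (metis Ints_minus minus_diff_eq)
  show "transp (\<lambda>x y :: real. x - y \<in> \<int>)"
    by (rule transpI) (metis Ints_add diff_add_cancel add_diff_eq)
qed

instantiation circle :: ab_group_add
begin

lift_definition zero_circle :: circle is "0 :: real" .

lift_definition plus_circle :: "circle \<Rightarrow> circle \<Rightarrow> circle" is "(+)"
  by (metis Ints_add add_diff_add)

lift_definition uminus_circle :: "circle \<Rightarrow> circle" is uminus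
  by (metis Ints_minus minus_diff_minus)

lift_definition minus_circle :: "circle \<Rightarrow> circle \<Rightarrow> circle" is "(-)"
  by (smt (verit) Ints_diff)

instance
  by standard (transfer, simp add: algebra_simps)+

end

text \<open>The quotient topology.\<close>

instantiation circle :: topological_space
begin

definition open_circle :: "circle set \<Rightarrow> bool" where
  "open_circle U \<longleftrightarrow> open (to_circle -` U)"

instance
  by standard (auto simp: open_circle_def vimage_Union)

end

lemma continuous_on_to_circle: "continuous_on S to_circle"
  by (rule continuous_on_subset[of UNIV])
     (auto simp: continuous_on_open_vimage open_circle_def)

lemma measurable_to_circle [measurable]: "to_circle \<in> borel_measurable borel"
  by (rule borel_measurable_continuous_onI[OF continuous_on_to_circle])

text \<open>Normalized Lebesgue (Haar) measure, transported from the fundamental domain \<open>[0,1)\<close>.\<close>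

definition haar_circle :: "circle measure" where
  "haar_circle = distr (restrict_space lborel {0..<1}) borel to_circle"

lemma emeasure_haar_circle:
  assumes "B \<in> sets borel"
  shows "emeasure haar_circle B = emeasure lborel (to_circle -` B \<inter> {0..<1})"
proof -
  have "to_circle \<in> restrict_space lborel {0..<1} \<rightarrow>\<^sub>M borel"
    by (rule measurable_restrict_space1) simp
  then show ?thesis
    using assms
    by (simp add: haar_circle_def emeasure_distr emeasure_restrict_space space_restrict_space)
qed

lemma emeasure_haar_circle_UNIV: "emeasure haar_circle UNIV = 1"
  by (simp add: emeasure_haar_circle)

definition covering_hom :: "nat \<Rightarrow> circle \<Rightarrow> circle" where
  "covering_hom n x = (\<Sum>i<n. x)"

lemma covering_hom_to_circle: "covering_hom n (to_circle x) = to_circle (real n * x)"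
proof (induction n)
  case 0
  then show ?case by (simp add: covering_hom_def zero_circle.abs_eq)
next
  case (Suc n)
  then show ?case
    by (simp add: covering_hom_def plus_circle.abs_eq algebra_simps)
qed

end

theory Submission
  imports Defs
begin

text \<open>
  For a set \<open>A\<close> of doubling ratio below \<open>3\<close>, the right-hand side of the inequality is below
  \<open>4\<mu>(A)\<close>. The homomorphism \<open>\<pi>\<^sub>n\<close> stretches short arcs by the factor \<open>n\<close>, so a short arc of length
  \<open>a\<close> inside \<open>A\<close> alone forces the left-hand side to be at least \<open>2na \<ge> 6a\<close>. Hence the inequality
  holds as soon as one short arc makes up two thirds of \<open>A\<close>, and the only real constraint is
  that the ratio should lie strictly between \<open>2\<close> and \<open>3\<close>. A single short arc has ratio exactly
  \<open>2\<close>, and two short arcs of lengths \<open>a\<close> and \<open>b\<close> in general position have ratio exactly \<open>3\<close>,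
  because the three pairwise sums are disjoint and have lengths \<open>2a\<close>, \<open>a + b\<close> and \<open>2b\<close>. The
  ratio drops below \<open>3\<close> when the second arc is based at the element \<open>1/2\<close> of order two: its
  sum with itself then falls back into the sum of the first arc with itself, if \<open>b \<le> a\<close>.

  Concretely, let \<open>A\<close> be the union of the arc from \<open>0\<close> of length \<open>2c\<close> and the arc from \<open>1/2\<close> of
  length \<open>c\<close>, with \<open>c\<close> small. Then \<open>A + A\<close> is the union of the arc from \<open>0\<close> of length \<open>4c\<close> and
  the arc from \<open>1/2\<close> of length \<open>3c\<close>, so the ratio is \<open>7/3\<close> and the right-hand side of the
  inequality is \<open>2(7c - 3c) = 8c\<close>. On the other side, \<open>\<pi>\<^sub>n(A) + \<pi>\<^sub>n(A)\<close> contains the arc from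
  \<open>0\<close> of length \<open>4nc\<close>, and \<open>4nc > 8c\<close> because \<open>n > 2\<close>.
\<close>

section \<open>Arcs of the circle\<close>

definition arc :: "real \<Rightarrow> real \<Rightarrow> circle set" where
  "arc a l = to_circle ` {a..a + l}"

lemma to_circle_eq_iff: "to_circle x = to_circle y \<longleftrightarrow> x - y \<in> \<int>"
  by (rule circle.abs_eq_iff)

lemma arc_mono: "l \<le> m \<Longrightarrow> arc a l \<subseteq> arc a m"
  by (auto simp: arc_def)

lemma arc_shift_Ints:
  assumes "b - a \<in> \<int>"
  shows "arc b l = arc a l"
proof -
  have subset: "arc x l \<subseteq> arc y l" if "x - y \<in> \<int>" for x y
  proof
    fix z assume "z \<in> arc x l"
    then obtain t where t: "z = to_circle t" "x \<le> t" "t \<le> x + l"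
      by (auto simp: arc_def)
    have "z = to_circle (t - (x - y))"
      using that t(1) by (simp add: to_circle_eq_iff)
    moreover have "t - (x - y) \<in> {y..y + l}"
      using t by auto
    ultimately show "z \<in> arc y l"
      unfolding arc_def by blast
  qed
  have "a - b \<in> \<int>"
    using assms Ints_minus[of "b - a"] by simp
  with assms show ?thesis
    by (intro subset_antisym subset)
qed

lemma arc_plus_arc:
  assumes "0 \<le> l" "0 \<le> m"
  shows "arc a l + arc b m = arc (a + b) (l + m)"
proof
  show "arc a l + arc b m \<subseteq> arc (a + b) (l + m)"
    by (auto simp: arc_def set_plus_def plus_circle.abs_eq)
  show "arc (a + b) (l + m) \<subseteq> arc a l + arc b m"
  proof
    fix z assume "z \<in> arc (a + b) (l + m)"
    then obtain t where t: "z = to_circle t" "a + b \<le> t" "t \<le> a + b + (l + m)"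
      by (auto simp: arc_def)
    \<comment> \<open>The second summand starts at \<open>b\<close> and is moved only once the first has reached the end of
      its arc.\<close>
    define u where "u = min (t - b) (a + l)"
    have "to_circle u \<in> arc a l" "to_circle (t - u) \<in> arc b m"
      using t assms by (auto simp: arc_def u_def min_def)
    moreover have "z = to_circle u + to_circle (t - u)"
      by (simp add: plus_circle.abs_eq t)
    ultimately show "z \<in> arc a l + arc b m"
      by (auto intro: set_plus_intro)
  qed
qed

lemma covering_hom_arc:
  assumes "n > 0"
  shows "covering_hom n ` arc a l = arc (real n * a) (real n * l)"
proof -
  have "covering_hom n ` arc a l = to_circle ` ((*) (real n) ` {a..a + l})"
    by (simp add: arc_def image_image covering_hom_to_circle)
  also have "(*) (real n) ` {a..a + l} = {real n * a..real n * a + real n * l}"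
    using assms by (simp add: image_mult_atLeastAtMost distrib_left)
  finally show ?thesis
    by (simp add: arc_def)
qed

lemma compact_arc: "compact (arc a l)"
  unfolding arc_def by (intro compact_continuous_image continuous_on_to_circle compact_Icc)

text \<open>The saturation of a compact set of reals is its sum with the closed set of integers.\<close>

lemma closed_to_circle_image:
  assumes "compact K"
  shows "closed (to_circle ` K)"
proof -
  have "to_circle -` (to_circle ` K) = (\<Union>x\<in>K. \<Union>y\<in>\<int>. {x + y})"
  proof (intro set_eqI iffI)
    fix z assume "z \<in> to_circle -` (to_circle ` K)"
    then obtain x where "x \<in> K" "z - x \<in> \<int>"
      by (auto simp: to_circle_eq_iff)
    moreover have "z = x + (z - x)"
      by simp
    ultimately show "z \<in> (\<Union>x\<in>K. \<Union>y\<in>\<int>. {x + y})"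
      by blast
  next
    fix z assume "z \<in> (\<Union>x\<in>K. \<Union>y\<in>\<int>. {x + y})"
    then obtain x y where "x \<in> K" "y \<in> \<int>" "z = x + y"
      by blast
    then have "to_circle z = to_circle x"
      by (simp add: to_circle_eq_iff)
    with \<open>x \<in> K\<close> show "z \<in> to_circle -` (to_circle ` K)"
      by simp
  qed
  then have "closed (to_circle -` (to_circle ` K))"
    using compact_closed_sums[OF assms closed_Ints] by simp
  then show ?thesis
    by (simp add: closed_def open_circle_def vimage_Compl)
qed

lemma arc_in_borel [measurable]: "arc a l \<in> sets borel"
  unfolding arc_def by (intro borel_closed closed_to_circle_image compact_Icc)


section \<open>The Haar measure of arcs\<close>

lemma sets_haar_circle [simp]: "sets haar_circle = sets borel"
  by (simp add: haar_circle_def)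

lemma haar_circle_mono:
  assumes "X \<subseteq> Y" "X \<in> sets borel" "Y \<in> sets borel"
  shows "measure haar_circle X \<le> measure haar_circle Y"
proof -
  have "space haar_circle = UNIV"
    by (simp add: haar_circle_def)
  then interpret finite_measure haar_circle
    by (intro finite_measureI) (simp add: emeasure_haar_circle_UNIV)
  show ?thesis
    using assms by (intro finite_measure_mono) auto
qed

text \<open>Sets inside the fundamental domain keep their Lebesgue measure, since \<open>to_circle\<close> is
  injective there.\<close>

lemma measure_to_circle_image:
  assumes "compact K" "K \<subseteq> {0..<1}"
  shows "measure haar_circle (to_circle ` K) = measure lborel K"
proof -
  have "to_circle -` (to_circle ` K) \<inter> {0..<1} = K"
  proof (intro set_eqI iffI)
    fix z assume "z \<in> to_circle -` (to_circle ` K) \<inter> {0..<1}"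
    then obtain x where x: "x \<in> K" "z - x \<in> \<int>" and z: "0 \<le> z" "z < 1"
      by (auto simp: to_circle_eq_iff)
    have "0 \<le> x" "x < 1"
      using x(1) assms(2) by auto
    with z have "\<bar>z - x\<bar> < 1"
      by linarith
    with x(2) have "z - x = 0"
      using Ints_nonzero_abs_less1 by blast
    with x(1) show "z \<in> K"
      by simp
  qed (use assms in auto)
  moreover have "to_circle ` K \<in> sets borel"
    by (intro borel_closed closed_to_circle_image assms)
  ultimately show ?thesis
    by (simp add: measure_def emeasure_haar_circle)
qed

lemma measure_arc:
  assumes "0 \<le> a" "0 \<le> l" "a + l < 1"
  shows "measure haar_circle (arc a l) = l"
  using assms unfolding arc_def by (subst measure_to_circle_image) auto

lemma measure_arc_Un_arc:
  assumes "0 \<le> a" "0 \<le> l" "a + l < b" "0 \<le> m" "b + m < 1"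
  shows "measure haar_circle (arc a l \<union> arc b m) = l + m"
proof -
  have "measure haar_circle (arc a l \<union> arc b m) = measure lborel ({a..a + l} \<union> {b..b + m})"
    unfolding arc_def image_Un[symmetric]
    using assms by (intro measure_to_circle_image) auto
  also have "\<dots> = measure lborel {a..a + l} + measure lborel {b..b + m}"
    using assms by (intro measure_Union) auto
  finally show ?thesis
    using assms by simp
qed


section \<open>The two-arc example\<close>

lemma Un_plus_Un_self:
  fixes X Y :: "'a::ab_semigroup_add set"
  shows "(X \<union> Y) + (X \<union> Y) = X + X \<union> (X + Y) \<union> (Y + Y)"
  unfolding Un_set_plus set_plus_Un add.commute[of Y X] by blast

lemma two_arcs_plus_self:
  assumes "0 \<le> c"
  shows "(arc 0 (2*c) \<union> arc (1/2) c) + (arc 0 (2*c) \<union> arc (1/2) c)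
    = arc 0 (4*c) \<union> arc (1/2) (3*c)"
proof -
  have "arc (1/2) c + arc (1/2) c = arc 1 (2*c)"
    using assms by (simp add: arc_plus_arc)
  also have "\<dots> = arc 0 (2*c)"
    by (rule arc_shift_Ints) simp
  also have "\<dots> \<subseteq> arc 0 (4*c)"
    using assms by (intro arc_mono) simp
  finally have "arc (1/2) c + arc (1/2) c \<subseteq> arc 0 (4*c)" .
  then show ?thesis
    using assms by (auto simp: Un_plus_Un_self arc_plus_arc)
qed

text \<open>The point \<open>n/2\<close> of the circle is \<open>0\<close> or \<open>1/2\<close> according to the parity of \<open>n\<close>; the bound covers
  both cases, as for even \<open>n\<close> the second arc is absorbed by the first.\<close>

lemma covering_hom_two_arcs_subset:
  assumes "n > 0" "0 \<le> c"
  shows "covering_hom n ` (arc 0 (2*c) \<union> arc (1/2) c)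
    \<subseteq> arc 0 (2*(real n*c)) \<union> arc (1/2) (real n*c)"
proof -
  have "arc (real n / 2) (real n * c) \<subseteq> arc 0 (2*(real n*c)) \<union> arc (1/2) (real n*c)"
  proof (cases "even n")
    case True
    then obtain k where "n = 2 * k" ..
    then have "arc (real n / 2) (real n * c) = arc 0 (real n * c)"
      by (intro arc_shift_Ints) simp
    moreover have "arc 0 (real n * c) \<subseteq> arc 0 (2*(real n*c))"
      using assms by (intro arc_mono) simp
    ultimately show ?thesis
      by blast
  next
    case False
    then obtain k where "n = 2 * k + 1" ..
    then have "real n / 2 - 1 / 2 = real k"
      by (simp add: field_simps)
    then have "arc (real n / 2) (real n * c) = arc (1/2) (real n * c)"
      by (intro arc_shift_Ints) simp
    then show ?thesis
      by blast
  qed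
  then show ?thesis
    using assms(1) by (simp add: image_Un covering_hom_arc mult.left_commute)
qed

theorem proposition5p3:
  fixes n :: nat and \<epsilon> :: real
  assumes "n \<ge> 3" and "\<epsilon> > 0"
  shows "\<exists>A :: circle set. compact A \<and>
    0 < measure haar_circle (covering_hom n ` A) \<and>
    measure haar_circle (covering_hom n ` A) < \<epsilon> \<and>
    2 < measure haar_circle (A + A) / measure haar_circle A \<and>
    measure haar_circle (A + A) / measure haar_circle A < 3 \<and>
    measure haar_circle (covering_hom n ` A + covering_hom n ` A)
      > 2 * (measure haar_circle (A + A) - measure haar_circle A)"
proof -
  \<comment> \<open>Downstairs, the arcs that occur have length at most \<open>4nc \<le> 1/2\<close>, so they do not wrap
    around, and \<open>\<pi>\<^sub>n(A)\<close> has measure at most \<open>3nc < \<epsilon>\<close>.\<close>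
  define c where "c = min 1 \<epsilon> / (8 * real n)"
  define A where "A = arc 0 (2*c) \<union> arc (1/2) c"
  define d where "d = real n * c"
  have d: "d = min 1 \<epsilon> / 8"
    using assms by (simp add: d_def c_def)
  have n: "n > 0"
    using assms(1) by simp
  have c: "c > 0"
    using assms by (simp add: c_def)
  have d_bounds: "d > 0" "8 * d \<le> 1" "3 * d < \<epsilon>"
    using assms(2) by (auto simp: d)
  have "3 * c \<le> d"
    using assms(1) c by (simp add: d_def)

  have A: "measure haar_circle A = 3 * c"
    unfolding A_def using c \<open>3 * c \<le> d\<close> d_bounds by (subst measure_arc_Un_arc) auto
  have AA: "measure haar_circle (A + A) = 7 * c"
    unfolding A_def two_arcs_plus_self[OF less_imp_le[OF c]]
    using c \<open>3 * c \<le> d\<close> d_bounds by (subst measure_arc_Un_arc) auto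

  define B where "B = covering_hom n ` A"
  have B: "B = arc 0 (2*d) \<union> arc (real n / 2) d"
    using n by (simp add: B_def A_def image_Un covering_hom_arc d_def mult.left_commute)
  have "2 * d = measure haar_circle (arc 0 (2*d))"
    using d_bounds by (simp add: measure_arc)
  also have "\<dots> \<le> measure haar_circle B"
    by (intro haar_circle_mono) (auto simp: B)
  finally have B_lower: "2 * d \<le> measure haar_circle B" .
  have "measure haar_circle B \<le> measure haar_circle (arc 0 (2*d) \<union> arc (1/2) d)"
  proof (intro haar_circle_mono)
    show "B \<subseteq> arc 0 (2*d) \<union> arc (1/2) d"
      using covering_hom_two_arcs_subset[OF n, of c] c by (simp add: B_def A_def d_def)
  qed (auto simp: B)
  also have "\<dots> = 3 * d"
    using d_bounds by (subst measure_arc_Un_arc) auto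
  finally have B_upper: "measure haar_circle B \<le> 3 * d" .

  have BB: "B + B = arc 0 (4*d) \<union> arc (real n / 2) (3*d) \<union> arc (real n) (2*d)"
    using d_bounds by (simp add: B Un_plus_Un_self arc_plus_arc)
  have "4 * d = measure haar_circle (arc 0 (4*d))"
    using d_bounds by (simp add: measure_arc)
  also have "\<dots> \<le> measure haar_circle (B + B)"
    by (intro haar_circle_mono) (auto simp: BB)
  finally have BB_lower: "4 * d \<le> measure haar_circle (B + B)" .

  have "compact A"
    unfolding A_def by (intro compact_Un compact_arc)
  moreover have "0 < measure haar_circle B" "measure haar_circle B < \<epsilon>"
    using B_lower B_upper d_bounds by linarith+
  moreover have "2 < measure haar_circle (A + A) / measure haar_circle A"
    "measure haar_circle (A + A) / measure haar_circle A < 3"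
    using c by (simp_all add: A AA)
  moreover have "2 * (measure haar_circle (A + A) - measure haar_circle A)
      < measure haar_circle (B + B)"
    using BB_lower \<open>3 * c \<le> d\<close> c by (simp add: A AA)
  ultimately show ?thesis
    unfolding B_def by blast
qed

end
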